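(* Let $m\geq 4$ be even, let $(\Gamma,G)\in\mathcal{OG}(m)$ with vertex set $X$, and let $N$ be a normal subgroup of $G$. Then $\Gamma_N$ is connected, $G$ induces a permutation group $\overline{G}$ on the set of $N$-orbits in $X$, and either $(\Gamma_N,\overline{G})=(K_1,1)$, or one of the following holds: (a) $(\Gamma_N,\overline{G})\in\mathcal{OG}(k)$ and $\Gamma$ is a $G$-normal $(m/k)$-multicover of $\Gamma_N$, for some even divisor $k$ of $m$; or (b) $(\Gamma_N,\overline{G})\in\mathcal{AG}(k)$ and $\Gamma$ is a $G$-normal $(m/k)$-multicover of $\Gamma_N$, for some divisor $k$ of $m$ with $m/k$ even (so $1\leq k\leq m/2$).
   Context: All graphs are finite, simple and undirected. For even $m\ge 2$, $\mathcal{OG}(m)$ is the set of pairs $(\Gamma,G)$ where $\Gamma$ is a connected graph of valency $m$ with vertex set $X$, and $G\leq\mathrm{Aut}(\Gamma)$ is transitive on $X$ and on edges, and $\Gamma$ is $G$-oriented: there is a $G$-orbit $\Delta\subset X\times X$, disjoint from $\Delta^*=\{(y,x)\mid (x,y)\in\Delta\}$, such that the edges of $\Gamma$ are exactly the pairs $\{x,y\}$ with $(x,y)\in\Delta$ or $(y,x)\in\Delta$. For $k\geq 1$, $\mathcal{AG}(k)$ is the set of pairs $(\Sigma,H)$ where $\Sigma$ is a connected graph of valency $k$ and $H\leq\mathrm{Aut}(\Sigma)$ is transitive on the arcs (ordered pairs of adjacent vertices) of $\Sigma$. For $N\trianglelefteq G$, the $G$-normal quotient $\Gamma_N$ is the graph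 whose vertices are the $N$-orbits in $X$, with distinct $N$-orbits $B,C$ adjacent if and only if there is an edge $\{x,y\}$ of $\Gamma$ with $x\in B$, $y\in C$; $\overline{G}$ is the permutation group induced by $G$ on the set of $N$-orbits. $\Gamma$ is a $G$-normal $\ell$-multicover of $\Gamma_N$ if, for each edge $\{B,C\}$ of $\Gamma_N$, each vertex of $B$ is joined by an edge of $\Gamma$ to exactly $\ell$ vertices of $C$. $K_1$ is the one-vertex graph. *)

theory Defs
  imports
    "HOL-Algebra.Group_Action"
    "Graph_Theory.Pair_Digraph"
    "Graph_Theory.Digraph_Component"
begin

text \<open>
  Finite simple undirected graphs are the locale \<open>pair_graph\<close>: each edge \<open>{x, y}\<close> is
  represented by the two arcs \<open>(x, y)\<close> and \<open>(y, x)\<close>, so \<open>parcs\<close> is the set of ordered pairs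
  of adjacent vertices.  A permutation group on \<open>X\<close> is given by its set of elements, which are
  functions in \<open>Bij X\<close>, i.e. they are \<open>undefined\<close> outside \<open>X\<close>.
\<close>

definition perm_group :: "'a set \<Rightarrow> ('a \<Rightarrow> 'a) set \<Rightarrow> ('a \<Rightarrow> 'a) monoid" where
  "perm_group X G = (BijGroup X)\<lparr>carrier := G\<rparr>"

definition Aut :: "'a pair_pre_digraph \<Rightarrow> ('a \<Rightarrow> 'a) set" where
  "Aut \<Gamma> = {f \<in> Bij (pverts \<Gamma>). \<forall>x \<in> pverts \<Gamma>. \<forall>y \<in> pverts \<Gamma>.
      (f x, f y) \<in> parcs \<Gamma> \<longleftrightarrow> (x, y) \<in> parcs \<Gamma>}"

definition edges :: "'a pair_pre_digraph \<Rightarrow> 'a set set" where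
  "edges \<Gamma> = {{x, y} | x y. (x, y) \<in> parcs \<Gamma>}"

definition act_pairs :: "('a \<times> 'a) set \<Rightarrow> ('a \<Rightarrow> 'a) \<Rightarrow> 'a \<times> 'a \<Rightarrow> 'a \<times> 'a" where
  "act_pairs S g = restrict (map_prod g g) S"

definition act_sets :: "'a set set \<Rightarrow> ('a \<Rightarrow> 'a) \<Rightarrow> 'a set \<Rightarrow> 'a set" where
  "act_sets S g = restrict (\<lambda>B. g ` B) S"

definition vertex_transitive :: "'a pair_pre_digraph \<Rightarrow> ('a \<Rightarrow> 'a) set \<Rightarrow> bool" where
  "vertex_transitive \<Gamma> G \<longleftrightarrow>
     transitive_action (perm_group (pverts \<Gamma>) G) (pverts \<Gamma>) (\<lambda>g. g)"

definition edge_transitive :: "'a pair_pre_digraph \<Rightarrow> ('a \<Rightarrow> 'a) set \<Rightarrow> bool" where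
  "edge_transitive \<Gamma> G \<longleftrightarrow>
     transitive_action (perm_group (pverts \<Gamma>) G) (edges \<Gamma>) (act_sets (edges \<Gamma>))"

definition arc_transitive :: "'a pair_pre_digraph \<Rightarrow> ('a \<Rightarrow> 'a) set \<Rightarrow> bool" where
  "arc_transitive \<Gamma> G \<longleftrightarrow>
     transitive_action (perm_group (pverts \<Gamma>) G) (parcs \<Gamma>) (act_pairs (parcs \<Gamma>))"

definition oriented :: "'a pair_pre_digraph \<Rightarrow> ('a \<Rightarrow> 'a) set \<Rightarrow> bool" where
  "oriented \<Gamma> G \<longleftrightarrow>
     (\<exists>\<Delta> \<in> orbits (perm_group (pverts \<Gamma>) G) (pverts \<Gamma> \<times> pverts \<Gamma>)
              (act_pairs (pverts \<Gamma> \<times> pverts \<Gamma>)).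
        \<Delta> \<inter> \<Delta>\<inverse> = {} \<and> parcs \<Gamma> = \<Delta> \<union> \<Delta>\<inverse>)"

definition has_valency :: "'a pair_pre_digraph \<Rightarrow> nat \<Rightarrow> bool" where
  "has_valency \<Gamma> m \<longleftrightarrow> (\<forall>x \<in> pverts \<Gamma>. out_degree (with_proj \<Gamma>) x = m)"

definition OG :: "nat \<Rightarrow> ('a pair_pre_digraph \<times> ('a \<Rightarrow> 'a) set) set" where
  "OG m = {(\<Gamma>, G). even m \<and> 2 \<le> m \<and>
     pair_graph \<Gamma> \<and> connected (with_proj \<Gamma>) \<and> has_valency \<Gamma> m \<and>
     subgroup G (perm_group (pverts \<Gamma>) (Aut \<Gamma>)) \<and>
     vertex_transitive \<Gamma> G \<and> edge_transitive \<Gamma> G \<and> oriented \<Gamma> G}"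

definition AG :: "nat \<Rightarrow> ('a pair_pre_digraph \<times> ('a \<Rightarrow> 'a) set) set" where
  "AG k = {(\<Sigma>, H). 1 \<le> k \<and>
     pair_graph \<Sigma> \<and> connected (with_proj \<Sigma>) \<and> has_valency \<Sigma> k \<and>
     subgroup H (perm_group (pverts \<Sigma>) (Aut \<Sigma>)) \<and> arc_transitive \<Sigma> H}"

definition orbits_on :: "'a set \<Rightarrow> ('a \<Rightarrow> 'a) set \<Rightarrow> 'a set set" where
  "orbits_on X N = orbits (perm_group X N) X (\<lambda>g. g)"

definition normal_quotient :: "'a pair_pre_digraph \<Rightarrow> ('a \<Rightarrow> 'a) set \<Rightarrow> 'a set pair_pre_digraph" where
  "normal_quotient \<Gamma> N =
     \<lparr>pverts = orbits_on (pverts \<Gamma>) N,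
      parcs = {(B, C). B \<in> orbits_on (pverts \<Gamma>) N \<and> C \<in> orbits_on (pverts \<Gamma>) N \<and> B \<noteq> C \<and>
                       (\<exists>x \<in> B. \<exists>y \<in> C. (x, y) \<in> parcs \<Gamma>)}\<rparr>"

definition induced_group :: "'a set \<Rightarrow> ('a \<Rightarrow> 'a) set \<Rightarrow> ('a \<Rightarrow> 'a) set \<Rightarrow> ('a set \<Rightarrow> 'a set) set" where
  "induced_group X G N = act_sets (orbits_on X N) ` G"

definition multicover :: "nat \<Rightarrow> 'a pair_pre_digraph \<Rightarrow> ('a \<Rightarrow> 'a) set \<Rightarrow> bool" where
  "multicover l \<Gamma> N \<longleftrightarrow>
     (\<forall>(B, C) \<in> parcs (normal_quotient \<Gamma> N). \<forall>x \<in> B. card {y \<in> C. (x, y) \<in> parcs \<Gamma>} = l)"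

end

theory Submission
  imports Defs
begin

text \<open>
  Let \<open>D\<close> be the image of the orbital \<open>\<Delta>\<close> on the \<open>N\<close>-orbits; it is an orbital of the induced group.
  If \<open>D\<close> meets the diagonal it lies in it, and connectedness leaves a single \<open>N\<close>-orbit.
  Otherwise \<open>D\<close> and its converse are either equal, which makes the quotient arc-transitive, or
  disjoint, which makes it oriented. In a finite transitive group paired orbitals have the same
  out-degree, so out-neighbours and in-neighbours of a vertex meet each \<open>N\<close>-orbit that they
  reach in the same number \<open>s\<close> of points. In the first case both kinds lie in the same orbits and
  the covering multiplicity is \<open>2s\<close>; in the second case it is \<open>s\<close>.
\<close>

section \<open>Permutation groups and their orbitals\<close>

lemma perm_group_simps [simp]:
  "carrier (perm_group X G) = G"
  "(\<otimes>\<^bsub>perm_group X G\<^esub>) = (\<otimes>\<^bsub>BijGroup X\<^esub>)"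
  "\<one>\<^bsub>perm_group X G\<^esub> = (\<lambda>x \<in> X. x)"
  by (simp_all add: perm_group_def BijGroup_def)

text \<open>Membership is in the group of all bijections of \<open>X\<close>, with no graph in
  sight, so that the same lemmas serve \<open>G\<close> and \<open>N\<close> on the vertices and the
  induced group on the \<open>N\<close>-orbits.\<close>

locale permutation_group =
  fixes X :: "'a set" and G :: "('a \<Rightarrow> 'a) set"
  assumes subgroup_Bij: "subgroup G (BijGroup X)"
begin

lemma group_perm_group: "group (perm_group X G)"
  unfolding perm_group_def
  by (rule subgroup.subgroup_is_group[OF subgroup_Bij group_BijGroup])

lemma in_Bij: "g \<in> G \<Longrightarrow> g \<in> Bij X"
  using subgroup.subset[OF subgroup_Bij] by (auto simp: BijGroup_def)

lemma closed [simp]: "g \<in> G \<Longrightarrow> x \<in> X \<Longrightarrow> g x \<in> X"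
  using in_Bij Bij_imp_funcset by blast

lemma inj: "g \<in> G \<Longrightarrow> inj_on g X"
  using in_Bij by (auto simp: Bij_def bij_betw_def)

lemma image_eq: "g \<in> G \<Longrightarrow> g ` X = X"
  using in_Bij by (auto simp: Bij_def bij_betw_def)

lemma mult_eq: "g \<in> G \<Longrightarrow> h \<in> G \<Longrightarrow> g \<otimes>\<^bsub>BijGroup X\<^esub> h = compose X g h"
  using in_Bij by (simp add: BijGroup_def)

lemma compose_closed: "g \<in> G \<Longrightarrow> h \<in> G \<Longrightarrow> compose X g h \<in> G"
  using subgroup.m_closed[OF subgroup_Bij] mult_eq by metis

lemma id_closed: "(\<lambda>x \<in> X. x) \<in> G"
  using subgroup.one_closed[OF subgroup_Bij] by (simp add: BijGroup_def)

lemma inverse_closed: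
  assumes "g \<in> G"
  obtains h where "h \<in> G" "\<And>x. x \<in> X \<Longrightarrow> h (g x) = x" "\<And>x. x \<in> X \<Longrightarrow> g (h x) = x"
proof
  let ?h = "inv\<^bsub>BijGroup X\<^esub> g"
  have h: "?h = restrict (inv_into X g) X"
    using inv_BijGroup in_Bij[OF assms] by auto
  show "?h \<in> G" using subgroup.m_inv_closed[OF subgroup_Bij assms] .
  show "?h (g x) = x" if "x \<in> X" for x
    using that assms by (simp add: h inj inv_into_f_f)
  show "g (?h x) = x" if "x \<in> X" for x
    using that assms image_eq by (simp add: h f_inv_into_f)
qed

text \<open>One criterion for the actions on pairs and on sets. The library's actions are
  homomorphisms into \<open>BijGroup S\<close>, whose elements are \<open>undefined\<close> outside
  \<open>S\<close>; hence the \<open>restrict\<close>. Bijectivity follows because the inverse of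
  \<open>g\<close> in \<open>G\<close> acts as the inverse map.\<close>

lemma group_action_restrict:
  assumes closed: "\<And>g s. g \<in> G \<Longrightarrow> s \<in> S \<Longrightarrow> \<psi> g s \<in> S"
    and one: "\<And>s. s \<in> S \<Longrightarrow> \<psi> (\<lambda>x \<in> X. x) s = s"
    and comp: "\<And>g h s. g \<in> G \<Longrightarrow> h \<in> G \<Longrightarrow> s \<in> S \<Longrightarrow> \<psi> (compose X g h) s = \<psi> g (\<psi> h s)"
  shows "group_action (perm_group X G) S (\<lambda>g. restrict (\<psi> g) S)"
proof -
  have Bij: "restrict (\<psi> g) S \<in> Bij S" if g: "g \<in> G" for g
  proof -
    obtain h where h: "h \<in> G" "\<And>x. x \<in> X \<Longrightarrow> h (g x) = x" "\<And>x. x \<in> X \<Longrightarrow> g (h x) = x"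
      using inverse_closed[OF g] by blast
    have "compose X h g = (\<lambda>x \<in> X. x)" "compose X g h = (\<lambda>x \<in> X. x)"
      using h by (auto simp: compose_def)
    then have "\<psi> h (\<psi> g s) = s" "\<psi> g (\<psi> h s) = s" if "s \<in> S" for s
      using that comp[OF g h(1)] comp[OF h(1) g] one by metis+
    then have "bij_betw (\<psi> g) S S"
      using closed g h(1) by (intro bij_betw_byWitness[where f' = "\<psi> h"]) auto
    then show ?thesis by (simp add: Bij_def)
  qed
  have "(\<lambda>g. restrict (\<psi> g) S) \<in> hom (perm_group X G) (BijGroup S)"
  proof (rule homI)
    fix g h assume "g \<in> carrier (perm_group X G)" "h \<in> carrier (perm_group X G)"
    then have gh: "g \<in> G" "h \<in> G" by simp_all
    show "restrict (\<psi> (g \<otimes>\<^bsub>perm_group X G\<^esub> h)) S =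
      restrict (\<psi> g) S \<otimes>\<^bsub>BijGroup S\<^esub> restrict (\<psi> h) S"
      using gh Bij[of g] Bij[of h] closed[of h] comp[of g h]
      by (simp add: mult_eq) (auto simp: BijGroup_def compose_def[of S])
  qed (use Bij in \<open>auto simp: BijGroup_def\<close>)
  then show ?thesis
    unfolding group_action_def group_hom_def group_hom_axioms_def
    using group_perm_group group_BijGroup by blast
qed

lemma group_action_id: "group_action (perm_group X G) X (\<lambda>g. g)"
proof -
  have "(\<lambda>g. g) \<in> hom (perm_group X G) (BijGroup X)"
    using in_Bij by (auto simp: hom_def BijGroup_def compose_Bij compose_closed)
  then show ?thesis
    unfolding group_action_def group_hom_def group_hom_axioms_def
    using group_perm_group group_BijGroup by blast
qed

lemma group_action_pairs:
  assumes "S \<subseteq> X \<times> X" "\<And>g x y. g \<in> G \<Longrightarrow> (x, y) \<in> S \<Longrightarrow> (g x, g y) \<in> S"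
  shows "group_action (perm_group X G) S (act_pairs S)"
  unfolding act_pairs_def
  by (rule group_action_restrict) (use assms in \<open>auto simp: compose_def\<close>)

lemma group_action_sets:
  assumes "S \<subseteq> Pow X" "\<And>g B. g \<in> G \<Longrightarrow> B \<in> S \<Longrightarrow> g ` B \<in> S"
  shows "group_action (perm_group X G) S (act_sets S)"
  unfolding act_sets_def
proof (rule group_action_restrict)
  fix B assume "B \<in> S"
  then have B: "B \<subseteq> X" using assms by blast
  then show "(\<lambda>x \<in> X. x) ` B = B" by force
  show "compose X g h ` B = g ` h ` B" for g h :: "'a \<Rightarrow> 'a"
    unfolding image_image by (rule image_cong) (use B in \<open>auto simp: compose_def\<close>)
qed (use assms in auto)

section \<open>Orbitals: the orbits on ordered pairs\<close>

abbreviation orbitals :: "('a \<times> 'a) set set" where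
  "orbitals \<equiv> orbits (perm_group X G) (X \<times> X) (act_pairs (X \<times> X))"

lemma group_action_X_pairs: "group_action (perm_group X G) (X \<times> X) (act_pairs (X \<times> X))"
  by (rule group_action_pairs) auto

lemma orbit_pair:
  assumes "x \<in> X" "y \<in> X"
  shows "orbit (perm_group X G) (act_pairs (X \<times> X)) (x, y) = {(g x, g y) | g. g \<in> G}"
  using assms by (simp add: orbit_def act_pairs_def)

lemma orbitals_iff:
  "R \<in> orbitals \<longleftrightarrow> (\<exists>x \<in> X. \<exists>y \<in> X. R = {(g x, g y) | g. g \<in> G})"
proof -
  have "R \<in> orbitals \<longleftrightarrow>
    (\<exists>x \<in> X. \<exists>y \<in> X. R = orbit (perm_group X G) (act_pairs (X \<times> X)) (x, y))"
    unfolding orbits_def by blast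
  then show ?thesis by (simp add: orbit_pair)
qed

text \<open>Applied to an orbital and its converse, this yields the dichotomy between arc-transitive
  and oriented quotients.\<close>

lemma orbitals_disjoint: "R \<in> orbitals \<Longrightarrow> S \<in> orbitals \<Longrightarrow> R = S \<or> R \<inter> S = {}"
  by (rule group_action.disjoint_union[OF group_action_X_pairs])

lemma orbital_nonempty: "R \<in> orbitals \<Longrightarrow> R \<noteq> {}"
  using id_closed by (auto simp: orbitals_iff)

lemma orbital_subset: "R \<in> orbitals \<Longrightarrow> R \<subseteq> X \<times> X"
  by (auto simp: orbitals_iff)

lemma orbital_converse:
  assumes "R \<in> orbitals"
  shows "R\<inverse> \<in> orbitals"
proof -
  obtain x y where xy: "x \<in> X" "y \<in> X" "R = {(g x, g y) | g. g \<in> G}"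
    using assms by (auto simp: orbitals_iff)
  then have "R\<inverse> = {(g y, g x) | g. g \<in> G}" by auto
  then show ?thesis using xy by (auto simp: orbitals_iff)
qed

lemma orbital_invariant:
  assumes "R \<in> orbitals" "g \<in> G" "(x, y) \<in> R"
  shows "(g x, g y) \<in> R"
proof -
  obtain u v h where uv: "u \<in> X" "v \<in> X" "R = {(g u, g v) | g. g \<in> G}"
    and h: "h \<in> G" "x = h u" "y = h v"
    using assms by (auto simp: orbitals_iff)
  have "g x = compose X g h u" "g y = compose X g h v"
    using uv h by (simp_all add: compose_def)
  then show ?thesis using compose_closed[OF assms(2) h(1)] uv(3) by auto
qed

text \<open>Both pairs are images of one base pair \<open>(u, v)\<close>, under \<open>h\<close> and
  \<open>h'\<close>; undoing \<open>h\<close> and then applying \<open>h'\<close> carries the first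
  to the second.\<close>

lemma orbital_transitive:
  assumes "R \<in> orbitals" "(x, y) \<in> R" "(x', y') \<in> R"
  obtains g where "g \<in> G" "g x = x'" "g y = y'"
proof -
  obtain u v h h' where uv: "u \<in> X" "v \<in> X"
    and h: "h \<in> G" "x = h u" "y = h v" "h' \<in> G" "x' = h' u" "y' = h' v"
    using assms by (auto simp: orbitals_iff)
  obtain f where f: "f \<in> G" "\<And>x. x \<in> X \<Longrightarrow> f (h x) = x"
    using inverse_closed[OF h(1)] by blast
  have "compose X h' f x = x'" "compose X h' f y = y'"
    using uv h f by (simp_all add: compose_def)
  then show thesis using that compose_closed[OF h(4) f(1)] by blast
qed

end

section \<open>The automorphism group of a graph\<close>

lemma subgroup_Aut: "subgroup (Aut \<Gamma>) (BijGroup (pverts \<Gamma>))"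
proof (rule group.subgroupI[OF group_BijGroup])
  let ?X = "pverts \<Gamma>"
  show "Aut \<Gamma> \<subseteq> carrier (BijGroup ?X)" by (auto simp: Aut_def BijGroup_def)
  have "(\<lambda>x \<in> ?X. x) \<in> Aut \<Gamma>" by (simp add: Aut_def id_Bij)
  then show "Aut \<Gamma> \<noteq> {}" by blast
  fix f assume f: "f \<in> Aut \<Gamma>"
  then have fB: "f \<in> Bij ?X" by (simp add: Aut_def)
  have "(inv_into ?X f x, inv_into ?X f y) \<in> parcs \<Gamma> \<longleftrightarrow> (x, y) \<in> parcs \<Gamma>"
    if "x \<in> ?X" "y \<in> ?X" for x y
  proof -
    have "f ` ?X = ?X" using fB by (simp add: Bij_def bij_betw_def)
    then have "f (inv_into ?X f x) = x" "f (inv_into ?X f y) = y"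
      using that by (simp_all add: f_inv_into_f)
    moreover have "inv_into ?X f x \<in> ?X" "inv_into ?X f y \<in> ?X"
      using that fB Bij_inv_into_mem by fastforce+
    ultimately show ?thesis using f unfolding Aut_def by force
  qed
  then show "inv\<^bsub>BijGroup ?X\<^esub> f \<in> Aut \<Gamma>"
    using fB by (simp add: inv_BijGroup Aut_def restrict_inv_into_Bij)
  fix g assume g: "g \<in> Aut \<Gamma>"
  then have gB: "g \<in> Bij ?X" by (simp add: Aut_def)
  have "g x \<in> ?X" if "x \<in> ?X" for x using gB that Bij_imp_funcset by blast
  then have "compose ?X f g \<in> Aut \<Gamma>"
    using f g compose_Bij[OF fB gB] by (simp add: Aut_def compose_eq)
  then show "f \<otimes>\<^bsub>BijGroup ?X\<^esub> g \<in> Aut \<Gamma>"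
    using fB gB by (simp add: BijGroup_def)
qed

text \<open>Splits the condition in \<open>OG\<close> and \<open>AG\<close> into a part about
  permutations alone, which feeds the locales, and the preservation of adjacency, which is checked
  separately for the quotient.\<close>

lemma subgroup_of_Aut_iff:
  "subgroup G (perm_group (pverts \<Gamma>) (Aut \<Gamma>)) \<longleftrightarrow> subgroup G (BijGroup (pverts \<Gamma>)) \<and> G \<subseteq> Aut \<Gamma>"
  (is "?L \<longleftrightarrow> ?R")
proof
  assume L: ?L
  then have "G \<subseteq> Aut \<Gamma>" using subgroup.subset by fastforce
  then show ?R
    using L group.incl_subgroup[OF group_BijGroup subgroup_Aut] by (simp add: perm_group_def)
next
  assume ?R
  then show ?L
    unfolding perm_group_def
    using group.subgroup_incl[OF group_BijGroup _ subgroup_Aut] by blast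
qed

section \<open>Graphs whose arcs come from a single orbital\<close>

context permutation_group
begin

text \<open>Invariance of the orbital gives one direction of the equivalence in \<open>Aut\<close>;
  the other is the same fact for the inverse element.\<close>

lemma orbital_union_subset_Aut:
  assumes R: "R \<in> orbitals" and \<Sigma>: "pverts \<Sigma> = X" "parcs \<Sigma> = R \<union> R\<inverse>"
  shows "G \<subseteq> Aut \<Sigma>"
proof
  fix g assume g: "g \<in> G"
  obtain h where h: "h \<in> G" "\<And>x. x \<in> X \<Longrightarrow> h (g x) = x"
    using inverse_closed[OF g] by blast
  have fwd: "(f x, f y) \<in> parcs \<Sigma>" if "f \<in> G" "(x, y) \<in> parcs \<Sigma>" for f x y
    using that orbital_invariant[OF R] \<Sigma>(2) by auto
  have "(g x, g y) \<in> parcs \<Sigma> \<longleftrightarrow> (x, y) \<in> parcs \<Sigma>" if "x \<in> X" "y \<in> X" for x y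
    using fwd[OF g] fwd[OF h(1)] h(2) that by metis
  then show "g \<in> Aut \<Sigma>" using in_Bij[OF g] \<Sigma>(1) by (simp add: Aut_def)
qed

lemma arc_transitive_orbital:
  assumes R: "R \<in> orbitals" and \<Sigma>: "pverts \<Sigma> = X" "parcs \<Sigma> = R"
  shows "arc_transitive \<Sigma> G"
  unfolding arc_transitive_def \<Sigma> transitive_action_def transitive_action_axioms_def
proof (intro conjI allI impI)
  show "group_action (perm_group X G) R (act_pairs R)"
    by (rule group_action_pairs) (use orbital_subset[OF R] orbital_invariant[OF R] in auto)
  fix p p' assume p: "p \<in> R" "p' \<in> R"
  then obtain g where "g \<in> G" "g (fst p) = fst p'" "g (snd p) = snd p'"
    using orbital_transitive[OF R, of "fst p" "snd p" "fst p'" "snd p'"] by auto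
  then show "\<exists>g \<in> carrier (perm_group X G). act_pairs R g p = p'"
    using p(1) by (intro bexI[of _ g]) (auto simp: act_pairs_def prod_eq_iff)
qed

text \<open>Every edge can be written \<open>{x, y}\<close> with \<open>(x, y)\<close> in
  \<open>R\<close>, even if it was found through the converse arc, so transitivity on
  \<open>R\<close> suffices.\<close>

lemma edge_transitive_orbital:
  assumes R: "R \<in> orbitals" and \<Sigma>: "pverts \<Sigma> = X" "parcs \<Sigma> = R \<union> R\<inverse>"
  shows "edge_transitive \<Sigma> G"
  unfolding edge_transitive_def \<Sigma>(1) transitive_action_def transitive_action_axioms_def
proof (intro conjI allI impI)
  have edges: "edges \<Sigma> = {{x, y} | x y. (x, y) \<in> R}"
  proof (intro equalityI subsetI)
    fix e assume "e \<in> edges \<Sigma>"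
    then obtain x y where "e = {x, y}" "(x, y) \<in> R \<or> (y, x) \<in> R"
      unfolding edges_def \<Sigma> by blast
    then show "e \<in> {{x, y} | x y. (x, y) \<in> R}" using insert_commute[of x y] by blast
  qed (auto simp: edges_def \<Sigma>)
  show "group_action (perm_group X G) (edges \<Sigma>) (act_sets (edges \<Sigma>))"
  proof (rule group_action_sets)
    show "edges \<Sigma> \<subseteq> Pow X" using orbital_subset[OF R] by (auto simp: edges)
    fix g e assume "g \<in> G" "e \<in> edges \<Sigma>"
    then obtain x y where "e = {x, y}" "(g x, g y) \<in> R"
      using orbital_invariant[OF R] unfolding edges by blast
    then show "g ` e \<in> edges \<Sigma>" unfolding edges by auto
  qed
  fix e e' assume e: "e \<in> edges \<Sigma>" "e' \<in> edges \<Sigma>"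
  then obtain x y x' y' where xy: "e = {x, y}" "e' = {x', y'}" "(x, y) \<in> R" "(x', y') \<in> R"
    unfolding edges by blast
  obtain g where g: "g \<in> G" "g x = x'" "g y = y'" using orbital_transitive[OF R xy(3,4)] .
  have "act_sets (edges \<Sigma>) g e = g ` e" using e(1) by (simp add: act_sets_def)
  also have "\<dots> = e'" using g(2,3) by (simp add: xy(1,2))
  finally show "\<exists>g \<in> carrier (perm_group X G). act_sets (edges \<Sigma>) g e = e'"
    using g(1) by auto
qed

end

section \<open>Counting neighbours in finite transitive groups\<close>

locale transitive_permutation_group = permutation_group +
  assumes transitive: "x \<in> X \<Longrightarrow> y \<in> X \<Longrightarrow> \<exists>g \<in> G. g x = y"
begin

lemma transitive_action_id: "transitive_action (perm_group X G) X (\<lambda>g. g)"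
  using group_action_id transitive
  by (simp add: transitive_action_def transitive_action_axioms_def)

text \<open>An element taking \<open>x\<close> to \<open>y\<close> injects the out-neighbours of
  \<open>x\<close> into those of \<open>y\<close>. Exchanging the two points turns the inequality
  into equality.\<close>

lemma orbital_out_le:
  assumes R: "R \<in> orbitals" and "finite X" "x \<in> X" "y \<in> X"
  shows "card (R `` {x}) \<le> card (R `` {y})"
proof -
  obtain g where g: "g \<in> G" "g x = y" using transitive assms by blast
  have sub: "R `` {z} \<subseteq> X" for z using orbital_subset[OF R] by blast
  show ?thesis
  proof (rule card_inj_on_le)
    show "inj_on g (R `` {x})" using inj[OF g(1)] sub by (rule inj_on_subset)
    show "g ` (R `` {x}) \<subseteq> R `` {y}" using orbital_invariant[OF R g(1)] g(2) by auto
    show "finite (R `` {y})" using sub assms(2) by (rule finite_subset)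
  qed
qed

lemma card_orbital:
  assumes R: "R \<in> orbitals" and "finite X" "x \<in> X"
  shows "card R = card X * card (R `` {x})"
proof -
  have "R \<subseteq> X \<times> X" by (rule orbital_subset[OF R])
  then have "R = (SIGMA y : X. R `` {y})" by blast
  also have "card \<dots> = (\<Sum>y \<in> X. card (R `` {y}))"
  proof (rule card_SigmaI)
    show "\<forall>y \<in> X. finite (R `` {y})"
      using orbital_subset[OF R] assms(2) by (auto intro: finite_subset)
  qed (rule assms(2))
  also have "\<dots> = (\<Sum>y \<in> X. card (R `` {x}))"
    using orbital_out_le[OF R] assms by (intro sum.cong refl le_antisym) auto
  finally show ?thesis by simp
qed

text \<open>A relation and its converse have equally many pairs, and each size is
  \<open>card X\<close> times the constant out-degree. Finiteness of \<open>X\<close> permits the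
  cancellation.\<close>

lemma orbital_out_eq_in:
  assumes R: "R \<in> orbitals" and "finite X" "x \<in> X"
  shows "card (R\<inverse> `` {x}) = card (R `` {x})"
proof -
  have "card X * card (R\<inverse> `` {x}) = card (R\<inverse>)"
    by (rule card_orbital[OF orbital_converse[OF R] assms(2,3), symmetric])
  also have "\<dots> = card R" by (rule card_inverse)
  also have "\<dots> = card X * card (R `` {x})" by (rule card_orbital[OF R assms(2,3)])
  finally have eq: "card X * card (R\<inverse> `` {x}) = card X * card (R `` {x})" .
  have "card X > 0" using assms(2,3) by (auto simp: card_gt_0_iff)
  with eq show ?thesis using nat_mult_eq_cancel1 by blast
qed

end

section \<open>The action on the orbits of a normal subgroup\<close>

locale normal_subgroup_orbits = transitive_permutation_group +
  fixes N :: "('a \<Rightarrow> 'a) set"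
  assumes normal: "N \<lhd> perm_group X G"
begin

abbreviation Y :: "'a set set" where "Y \<equiv> orbits_on X N"

abbreviation H :: "('a set \<Rightarrow> 'a set) set" where "H \<equiv> induced_group X G N"

text \<open>The projection to the quotient, as a function on points:
  \<open>map_prod N_orbit N_orbit\<close> then carries relations on \<open>X\<close> to relations on
  \<open>Y\<close>.\<close>

definition N_orbit :: "'a \<Rightarrow> 'a set" where
  "N_orbit x = {n x | n. n \<in> N}"

lemma N_subset: "N \<subseteq> G"
  using normal_imp_subgroup[OF normal] subgroup.subset by fastforce

lemma subgroup_N: "subgroup N (BijGroup X)"
proof -
  have "subgroup N (perm_group X G)" by (rule normal_imp_subgroup[OF normal])
  then show ?thesis
    unfolding perm_group_def by (rule group.incl_subgroup[OF group_BijGroup subgroup_Bij])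
qed

sublocale N: permutation_group X N
  by (rule permutation_group.intro[OF subgroup_N])

lemma N_orbit_eq_orbit: "N_orbit x = orbit (perm_group X N) (\<lambda>g. g) x"
  by (simp add: N_orbit_def orbit_def)

lemma Y_eq: "Y = N_orbit ` X"
  by (auto simp: orbits_on_def orbits_def N_orbit_eq_orbit)

lemma N_orbit_subset: "x \<in> X \<Longrightarrow> N_orbit x \<subseteq> X"
  by (auto simp: N_orbit_def)

lemma N_orbit_refl: "x \<in> X \<Longrightarrow> x \<in> N_orbit x"
  unfolding N_orbit_eq_orbit by (rule group_action.orbit_refl[OF N.group_action_id])

lemma N_orbit_eqI:
  assumes "x \<in> X" "y \<in> N_orbit x"
  shows "N_orbit y = N_orbit x"
proof -
  have "y \<in> X" using assms N_orbit_subset by blast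
  then have "N_orbit x \<in> Y" "N_orbit y \<in> Y" "y \<in> N_orbit x \<inter> N_orbit y"
    using assms N_orbit_refl by (auto simp: Y_eq)
  then show ?thesis
    using group_action.disjoint_union[OF N.group_action_id] unfolding orbits_on_def by blast
qed

lemma mem_Y:
  assumes "B \<in> Y"
  shows "x \<in> B \<longleftrightarrow> x \<in> X \<and> N_orbit x = B"
proof -
  obtain u where u: "u \<in> X" "B = N_orbit u" using assms by (auto simp: Y_eq)
  then show ?thesis using N_orbit_eqI[of u x] N_orbit_subset[of u] N_orbit_refl[of x] by blast
qed

text \<open>Normality enters here: \<open>g (n x)\<close> is the image of \<open>g x\<close> under
  the conjugate of \<open>n\<close> by \<open>g\<close>, which lies in \<open>N\<close>.\<close>

lemma image_N_orbit_subset: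
  assumes g: "g \<in> G" and x: "x \<in> X"
  shows "g ` N_orbit x \<subseteq> N_orbit (g x)"
proof
  fix z assume "z \<in> g ` N_orbit x"
  then obtain n where n: "n \<in> N" "z = g (n x)" by (auto simp: N_orbit_def)
  interpret A: group_action "perm_group X G" X "\<lambda>g. g" by (rule group_action_id)
  interpret P: group "perm_group X G" by (rule group_perm_group)
  let ?A = "perm_group X G"
  let ?n = "g \<otimes>\<^bsub>?A\<^esub> n \<otimes>\<^bsub>?A\<^esub> inv\<^bsub>?A\<^esub> g"
  have "?n \<in> N" using normal.inv_op_closed2[OF normal] g n by simp
  have i: "inv\<^bsub>?A\<^esub> g \<in> G" using P.inv_closed[of g] g by simp
  have nG: "n \<in> G" using n N_subset by blast
  have "?n (g x) = (g \<otimes>\<^bsub>?A\<^esub> n) ((inv\<^bsub>?A\<^esub> g) (g x))"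
    using A.composition_rule[of "g x" "g \<otimes>\<^bsub>?A\<^esub> n" "inv\<^bsub>?A\<^esub> g"] g x i nG P.m_closed[of g n] by simp
  also have "(inv\<^bsub>?A\<^esub> g) (g x) = x" using A.orbit_sym_aux[of g x "g x"] g x by simp
  also have "(g \<otimes>\<^bsub>?A\<^esub> n) x = g (n x)" using A.composition_rule[of x g n] g x nG by simp
  finally have "z = ?n (g x)" by (simp only: n(2))
  with \<open>?n \<in> N\<close> show "z \<in> N_orbit (g x)"
    unfolding N_orbit_def by (intro CollectI exI[of _ ?n] conjI)
qed

text \<open>The reverse inclusion is the previous lemma for the inverse of \<open>g\<close> at the
  point \<open>g x\<close>.\<close>

lemma image_N_orbit:
  assumes g: "g \<in> G" and x: "x \<in> X"
  shows "g ` N_orbit x = N_orbit (g x)"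
proof
  obtain h where h: "h \<in> G" "\<And>x. x \<in> X \<Longrightarrow> h (g x) = x" "\<And>x. x \<in> X \<Longrightarrow> g (h x) = x"
    using inverse_closed[OF g] by blast
  have "h ` N_orbit (g x) \<subseteq> N_orbit x"
    using image_N_orbit_subset[OF h(1), of "g x"] h g x by simp
  moreover have "N_orbit (g x) = g ` h ` N_orbit (g x)"
    using h(3) N_orbit_subset[of "g x"] g x by (force simp: image_image)
  ultimately show "N_orbit (g x) \<subseteq> g ` N_orbit x" by blast
qed (rule image_N_orbit_subset[OF assms])

lemma group_action_Y: "group_action (perm_group X G) Y (act_sets Y)"
  by (rule group_action_sets) (use N_orbit_subset image_N_orbit in \<open>auto simp: Y_eq\<close>)

lemma act_sets_N_orbit: "x \<in> X \<Longrightarrow> g \<in> G \<Longrightarrow> act_sets Y g (N_orbit x) = N_orbit (g x)"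
  by (simp add: act_sets_def Y_eq image_N_orbit)

lemma subgroup_H: "subgroup H (BijGroup Y)"
  using group_hom.img_is_subgroup[OF group_action.group_hom[OF group_action_Y]]
  by (simp add: induced_group_def)

lemma transitive_H:
  assumes "B \<in> Y" "C \<in> Y"
  shows "\<exists>h \<in> H. h B = C"
proof -
  obtain x y where xy: "x \<in> X" "y \<in> X" "B = N_orbit x" "C = N_orbit y"
    using assms by (auto simp: Y_eq)
  obtain g where g: "g \<in> G" "g x = y" using transitive xy by blast
  have "act_sets Y g B = C" using xy g by (simp add: act_sets_N_orbit)
  then show ?thesis using g(1) by (auto simp: induced_group_def)
qed

sublocale H: transitive_permutation_group Y H
  by (intro transitive_permutation_group.intro permutation_group.intro
      transitive_permutation_group_axioms.intro subgroup_H transitive_H)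

text \<open>\<open>N_orbit\<close> intertwines the action of \<open>G\<close> on points with that on
  \<open>N\<close>-orbits, so it maps an orbit on pairs onto an orbit on pairs.\<close>

lemma orbital_quotient:
  assumes R: "R \<in> orbitals"
  shows "map_prod N_orbit N_orbit ` R \<in> H.orbitals"
proof -
  obtain x y where xy: "x \<in> X" "y \<in> X" and R: "R = {(g x, g y) | g. g \<in> G}"
    using R by (auto simp: orbitals_iff)
  have "map_prod N_orbit N_orbit ` R = {(N_orbit (g x), N_orbit (g y)) | g. g \<in> G}"
    unfolding R by (auto simp: image_iff)
  \<comment> \<open>\<open>rev_conj_cong\<close> makes \<open>g \<in> G\<close> available while the
    equation in front of it is rewritten.\<close>
  also have "\<dots> = {(act_sets Y g (N_orbit x), act_sets Y g (N_orbit y)) | g. g \<in> G}"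
    using xy by (simp add: act_sets_N_orbit cong: rev_conj_cong)
  also have "\<dots> = {(h (N_orbit x), h (N_orbit y)) | h. h \<in> H}"
    unfolding induced_group_def by blast
  finally have "map_prod N_orbit N_orbit ` R = {(h (N_orbit x), h (N_orbit y)) | h. h \<in> H}" .
  moreover have "N_orbit x \<in> Y" "N_orbit y \<in> Y" using xy by (simp_all add: Y_eq)
  ultimately show ?thesis unfolding H.orbitals_iff by blast
qed

text \<open>
  Correcting an element of \<open>G\<close> that maps \<open>(B, C)\<close> to \<open>(B', C')\<close> by an element of \<open>N\<close> lets it
  also map \<open>x\<close> to \<open>x'\<close>.
\<close>

lemma card_fibre_le:
  assumes R: "R \<in> orbitals" and fin: "finite X"
    and BC: "(B, C) \<in> map_prod N_orbit N_orbit ` R" "x \<in> B"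
    and BC': "(B', C') \<in> map_prod N_orbit N_orbit ` R" "x' \<in> B'"
  shows "card (C \<inter> R `` {x}) \<le> card (C' \<inter> R `` {x'})"
proof -
  obtain u v where uv: "(u, v) \<in> R" "B = N_orbit u" "C = N_orbit v" using BC by auto
  obtain u' v' where uv': "(u', v') \<in> R" "B' = N_orbit u'" "C' = N_orbit v'" using BC' by auto
  have X: "u \<in> X" "v \<in> X" "u' \<in> X" "v' \<in> X" using orbital_subset[OF R] uv uv' by auto
  obtain g where g: "g \<in> G" "g u = u'" "g v = v'" using orbital_transitive[OF R uv(1) uv'(1)] .
  have gB: "g ` B = B'" and gC: "g ` C = C'" using g X uv uv' image_N_orbit by auto
  have x: "x \<in> X" using BC(2) uv X N_orbit_subset by blast
  have "g x \<in> B'" using gB BC(2) by blast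
  then have "N_orbit (g x) = B'" using N_orbit_eqI uv' X by blast
  then obtain n where n: "n \<in> N" "n (g x) = x'" using BC'(2) by (auto simp: N_orbit_def)
  have nG: "n \<in> G" using n N_subset by blast
  \<comment> \<open>The correction by \<open>n\<close> leaves the target fibre alone, since elements
    of \<open>N\<close> preserve each \<open>N\<close>-orbit.\<close>
  have nC: "n ` C' \<subseteq> C'"
    using image_N_orbit[OF nG X(4)] N_orbit_eqI[OF X(4), of "n v'"] n(1) uv'(3)
    by (auto simp: N_orbit_def)
  let ?h = "compose X n g"
  have h: "?h \<in> G" using compose_closed[OF nG g(1)] .
  have C: "C \<subseteq> X" using uv X N_orbit_subset by blast
  show ?thesis
  proof (rule card_inj_on_le)
    have "C \<inter> R `` {x} \<subseteq> X" using C by blast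
    then show "inj_on ?h (C \<inter> R `` {x})" using inj[OF h] inj_on_subset by blast
    show "?h ` (C \<inter> R `` {x}) \<subseteq> C' \<inter> R `` {x'}"
    proof (rule image_subsetI)
      fix y assume y: "y \<in> C \<inter> R `` {x}"
      then have "?h y = n (g y)" using C by (auto simp: compose_def)
      moreover have "g y \<in> C'" using y gC by blast
      ultimately have "?h y \<in> C'" using nC by auto
      moreover have "?h x = x'" using x n by (simp add: compose_def)
      moreover have "(?h x, ?h y) \<in> R" by (rule orbital_invariant[OF R h]) (use y in simp)
      ultimately show "?h y \<in> C' \<inter> R `` {x'}" by simp
    qed
    have "R `` {x'} \<subseteq> X" using orbital_subset[OF R] by blast
    then show "finite (C' \<inter> R `` {x'})" using fin finite_subset by blast
  qed
qed

text \<open>The comparison of fibres in both directions makes their size a constant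
  \<open>s\<close>. The out-neighbours of a point are partitioned by the \<open>N\<close>-orbits
  adjacent to its own under the image relation, each contributing \<open>s\<close>.\<close>

lemma orbital_fibres:
  assumes R: "R \<in> orbitals" and fin: "finite X"
  obtains s where "s > 0"
    "\<And>B C x. (B, C) \<in> map_prod N_orbit N_orbit ` R \<Longrightarrow> x \<in> B \<Longrightarrow> card (C \<inter> R `` {x}) = s"
    "\<And>x. x \<in> X \<Longrightarrow> card (R `` {x}) = card ((map_prod N_orbit N_orbit ` R) `` {N_orbit x}) * s"
proof -
  let ?D = "map_prod N_orbit N_orbit ` R"
  obtain u v where uv: "(u, v) \<in> R" using orbital_nonempty[OF R] by auto
  then have X: "u \<in> X" "v \<in> X" using orbital_subset[OF R] by auto
  \<comment> \<open>The constant is read off at one arc \<open>(u, v)\<close>; it is positive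
    because \<open>v\<close> itself is counted.\<close>
  define s where "s = card (N_orbit v \<inter> R `` {u})"
  have finR: "finite (R `` {x})" for x
    using orbital_subset[OF R] fin by (auto intro: finite_subset)
  have pos: "s > 0" using uv finR N_orbit_refl[OF X(2)] by (auto simp: s_def card_gt_0_iff)
  have uvD: "(N_orbit u, N_orbit v) \<in> ?D" using uv by force
  have s: "card (C \<inter> R `` {x}) = s" if "(B, C) \<in> ?D" "x \<in> B" for B C x
    unfolding s_def
    using card_fibre_le[OF R fin that uvD] card_fibre_le[OF R fin uvD _ that] N_orbit_refl[OF X(1)]
    by (simp add: le_antisym)
  have total: "card (R `` {x}) = card (?D `` {N_orbit x}) * s" if x: "x \<in> X" for x
  proof -
    have DY: "?D `` {N_orbit x} \<subseteq> Y" using orbital_subset[OF R] by (auto simp: Y_eq)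
    have "R `` {x} = (\<Union>C \<in> ?D `` {N_orbit x}. C \<inter> R `` {x})" (is "_ = ?U")
    proof
      show "R `` {x} \<subseteq> ?U"
      proof
        fix y assume y: "y \<in> R `` {x}"
        then have "y \<in> N_orbit y" using orbital_subset[OF R] N_orbit_refl by blast
        moreover have "N_orbit y \<in> ?D `` {N_orbit x}" using y by force
        ultimately show "y \<in> ?U" using y by blast
      qed
    qed auto
    also have "card \<dots> = (\<Sum>C \<in> ?D `` {N_orbit x}. card (C \<inter> R `` {x}))"
    proof (rule card_UN_disjoint)
      show "finite (?D `` {N_orbit x})" using finite_subset[OF DY] fin by (simp add: Y_eq)
      show "\<forall>C \<in> ?D `` {N_orbit x}. \<forall>C' \<in> ?D `` {N_orbit x}. C \<noteq> C' \<longrightarrow>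
        (C \<inter> R `` {x}) \<inter> (C' \<inter> R `` {x}) = {}"
      proof (intro ballI impI)
        fix C C' assume C: "C \<in> ?D `` {N_orbit x}" "C' \<in> ?D `` {N_orbit x}" "C \<noteq> C'"
        have "C \<in> Y" "C' \<in> Y" by (rule subsetD[OF DY C(1)], rule subsetD[OF DY C(2)])
        then have "C \<inter> C' = {}" using C(3) mem_Y by blast
        then show "(C \<inter> R `` {x}) \<inter> (C' \<inter> R `` {x}) = {}" by auto
      qed
    qed (use finR in blast)
    also have "\<dots> = (\<Sum>C \<in> ?D `` {N_orbit x}. s)"
    proof (rule sum.cong[OF refl])
      fix C assume "C \<in> ?D `` {N_orbit x}"
      then show "card (C \<inter> R `` {x}) = s" using s[of "N_orbit x" C x] N_orbit_refl[OF x] by simp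
    qed
    finally show ?thesis by simp
  qed
  show thesis using pos s total by (rule that)
qed

text \<open>\<open>G\<close> permutes the \<open>N\<close>-orbits and is transitive on
  \<open>R\<close>, so a single pair inside one \<open>N\<close>-orbit forces this for all pairs.
  This isolates the degenerate quotient.\<close>

lemma N_orbit_eq_on_orbital:
  assumes R: "R \<in> orbitals" and "(u, v) \<in> R" "N_orbit u = N_orbit v" "(x, y) \<in> R"
  shows "N_orbit x = N_orbit y"
proof -
  obtain g where "g \<in> G" "g u = x" "g v = y" using orbital_transitive[OF R assms(2,4)] .
  moreover have "u \<in> X" "v \<in> X" using orbital_subset[OF R] assms(2) by auto
  ultimately show ?thesis using image_N_orbit assms(3) by metis
qed

end

section \<open>Normal quotients of oriented graphs\<close>

lemma out_degree_with_proj: "out_degree (with_proj \<Gamma>) x = card (parcs \<Gamma> `` {x})"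
proof -
  have "out_arcs (with_proj \<Gamma>) x = Pair x ` (parcs \<Gamma> `` {x})"
    by (auto simp: out_arcs_def)
  then show ?thesis by (simp add: out_degree_def card_image inj_on_def)
qed

text \<open>Library connectedness is strong connectedness of the symmetric closure; unfolded, it
  speaks of walks that may use arcs in either direction and stay in the vertex set.\<close>

lemma connected_with_proj_iff:
  "connected (with_proj \<Gamma>) \<longleftrightarrow> pverts \<Gamma> \<noteq> {} \<and>
    (\<forall>u \<in> pverts \<Gamma>. \<forall>v \<in> pverts \<Gamma>. (u, v) \<in> rtrancl_on (pverts \<Gamma>) (parcs \<Gamma> \<union> (parcs \<Gamma>)\<inverse>))"
proof -
  have "parcs (mk_symmetric (with_proj \<Gamma>)) = parcs \<Gamma> \<union> (parcs \<Gamma>)\<inverse>"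
    by (auto simp: mk_symmetric_def)
  moreover have "pverts (mk_symmetric (with_proj \<Gamma>)) = pverts \<Gamma>"
    by (simp add: mk_symmetric_def)
  ultimately show ?thesis
    by (simp add: connected_def strongly_connected_def reachable_def)
qed

section \<open>Arcs and connectedness of the quotient, and its classification\<close>

context normal_subgroup_orbits
begin

lemma pverts_normal_quotient: "pverts \<Gamma> = X \<Longrightarrow> pverts (normal_quotient \<Gamma> N) = Y"
  by (simp add: normal_quotient_def)

lemma parcs_normal_quotient:
  assumes "pverts \<Gamma> = X" "parcs \<Gamma> \<subseteq> X \<times> X"
  shows "parcs (normal_quotient \<Gamma> N) = map_prod N_orbit N_orbit ` parcs \<Gamma> - Id"
proof (intro subset_antisym subsetI)
  fix p assume "p \<in> parcs (normal_quotient \<Gamma> N)"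
  then show "p \<in> map_prod N_orbit N_orbit ` parcs \<Gamma> - Id"
    using mem_Y by (force simp: normal_quotient_def assms(1))
next
  fix p assume "p \<in> map_prod N_orbit N_orbit ` parcs \<Gamma> - Id"
  then obtain x y where "p = (N_orbit x, N_orbit y)" "(x, y) \<in> parcs \<Gamma>" "N_orbit x \<noteq> N_orbit y"
    by auto
  then show "p \<in> parcs (normal_quotient \<Gamma> N)"
    using assms N_orbit_refl by (auto simp: normal_quotient_def Y_eq)
qed

text \<open>A walk projects to the quotient: a step inside an \<open>N\<close>-orbit becomes
  stationary, any other step becomes a quotient arc or its converse.\<close>

lemma connected_normal_quotient:
  assumes \<Gamma>: "pverts \<Gamma> = X" "parcs \<Gamma> \<subseteq> X \<times> X" and conn: "connected (with_proj \<Gamma>)"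
  shows "connected (with_proj (normal_quotient \<Gamma> N))"
proof -
  let ?\<Sigma> = "normal_quotient \<Gamma> N"
  let ?S = "parcs ?\<Sigma> \<union> (parcs ?\<Sigma>)\<inverse>"
  have "(N_orbit u, N_orbit v) \<in> rtrancl_on Y ?S"
    if "(u, v) \<in> rtrancl_on X (parcs \<Gamma> \<union> (parcs \<Gamma>)\<inverse>)" for u v
    using that
  proof (induction rule: rtrancl_on_induct)
    case base
    then show ?case by (auto simp: Y_eq)
  next
    case (step v w)
    show ?case
    proof (cases "N_orbit v = N_orbit w")
      case False
      then have "(N_orbit v, N_orbit w) \<in> ?S"
        using step by (force simp: parcs_normal_quotient[OF \<Gamma>])
      then show ?thesis using step
        by (auto simp: Y_eq intro: rtrancl_on_into_rtrancl_on)
    qed (use step in simp)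
  qed
  then show ?thesis
    using conn unfolding connected_with_proj_iff pverts_normal_quotient[OF \<Gamma>(1)] \<Gamma>(1)
    by (auto simp: Y_eq)
qed

text \<open>Outside the degenerate case let \<open>k\<close> be the out-degree of \<open>D\<close>
  and \<open>s\<close> the fibre size, so that \<open>m = 2 * k * s\<close>. If \<open>D\<close> is
  symmetric the quotient has valency \<open>k\<close> and multiplicity \<open>2 * s\<close>; if
  \<open>D\<close> and its converse are disjoint, it has valency \<open>2 * k\<close> and
  multiplicity \<open>s\<close>.\<close>

lemma normal_quotient_cases:
  assumes \<Gamma>: "pair_graph \<Gamma>" "pverts \<Gamma> = X" "connected (with_proj \<Gamma>)" "has_valency \<Gamma> m" "m > 0"
    and \<Delta>: "\<Delta> \<in> orbitals" "\<Delta> \<inter> \<Delta>\<inverse> = {}" "parcs \<Gamma> = \<Delta> \<union> \<Delta>\<inverse>"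
  shows "(\<exists>B. normal_quotient \<Gamma> N = \<lparr>pverts = {B}, parcs = {}\<rparr>) \<and> H = {\<lambda>B \<in> Y. B}
     \<or> (\<exists>k. even k \<and> k dvd m \<and> (normal_quotient \<Gamma> N, H) \<in> OG k \<and> multicover (m div k) \<Gamma> N)
     \<or> (\<exists>k. k dvd m \<and> even (m div k) \<and> 1 \<le> k \<and> k \<le> m div 2 \<and>
          (normal_quotient \<Gamma> N, H) \<in> AG k \<and> multicover (m div k) \<Gamma> N)"
proof -
  interpret \<Gamma>: pair_graph \<Gamma> by (rule \<Gamma>(1))
  let ?\<Sigma> = "normal_quotient \<Gamma> N"
  have fin: "finite X" using \<Gamma>.pair_finite_verts \<Gamma>(2) by simp
  have arcs: "parcs \<Gamma> \<subseteq> X \<times> X" using orbital_subset[OF \<Delta>(1)] \<Delta>(3) by auto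
  note pverts = pverts_normal_quotient[OF \<Gamma>(2)] and parcs = parcs_normal_quotient[OF \<Gamma>(2) arcs]
  have conn: "connected (with_proj ?\<Sigma>)" by (rule connected_normal_quotient[OF \<Gamma>(2) arcs \<Gamma>(3)])
  have finY: "finite Y" using fin by (simp add: Y_eq)
  obtain x\<^sub>0 where x\<^sub>0: "x\<^sub>0 \<in> X" using \<Gamma>(2,3) by (auto simp: connected_with_proj_iff)
  define D where "D = map_prod N_orbit N_orbit ` \<Delta>"
  have D: "D \<in> H.orbitals" unfolding D_def by (rule orbital_quotient[OF \<Delta>(1)])
  \<comment> \<open>Lets \<open>orbital_fibres\<close>, applied to the converse of
    \<open>\<Delta>\<close>, speak about the converse of \<open>D\<close>.\<close>
  have Dc: "D\<inverse> = map_prod N_orbit N_orbit ` \<Delta>\<inverse>" by (force simp: D_def)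
  have image_arcs: "map_prod N_orbit N_orbit ` parcs \<Gamma> = D \<union> D\<inverse>"
    unfolding Dc unfolding D_def \<Delta>(3) by (rule image_Un)
  show ?thesis
  proof (cases "\<exists>u v. (u, v) \<in> \<Delta> \<and> N_orbit u = N_orbit v")
    case True
    then have "N_orbit x = N_orbit y" if "(x, y) \<in> \<Delta>" for x y
      using N_orbit_eq_on_orbital[OF \<Delta>(1)] that by blast
    then have "D \<subseteq> Id" by (auto simp: D_def)
    then have no_arcs: "parcs ?\<Sigma> = {}" unfolding parcs image_arcs by auto
    have "B = N_orbit x\<^sub>0" if "B \<in> Y" for B
    proof -
      \<comment> \<open>Without arcs only trivial walks exist, so connectedness leaves one
        vertex.\<close>
      have "(B, N_orbit x\<^sub>0) \<in> rtrancl_on Y {}"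
        using conn that x\<^sub>0 by (auto simp: connected_with_proj_iff no_arcs pverts Y_eq)
      then show ?thesis by (cases rule: rtrancl_on.cases) auto
    qed
    then have Y: "Y = {N_orbit x\<^sub>0}" using x\<^sub>0 by (auto simp: Y_eq)
    then have \<Sigma>: "?\<Sigma> = \<lparr>pverts = {N_orbit x\<^sub>0}, parcs = {}\<rparr>" using pverts no_arcs by simp
    have "h = (\<lambda>B \<in> Y. B)" if "h \<in> H" for h
    proof (rule extensionalityI)
      show "h \<in> extensional Y" using H.in_Bij[OF that] by (simp add: Bij_def)
      show "h B = (\<lambda>B \<in> Y. B) B" if "B \<in> Y" for B
        using H.closed[OF \<open>h \<in> H\<close> that] that by (simp add: Y)
    qed (rule restrict_extensional)
    then have "H \<subseteq> {\<lambda>B \<in> Y. B}" by blast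
    then have "H = {\<lambda>B \<in> Y. B}" using H.id_closed by blast
    with \<Sigma> show ?thesis by blast
  next
    case False
    then have "D \<inter> Id = {}" by (auto simp: D_def)
    \<comment> \<open>Since \<open>D\<close> avoids the diagonal, removing loops changes nothing;
      from here \<open>parcs\<close> names this sharper equation.\<close>
    then have parcs: "parcs ?\<Sigma> = D \<union> D\<inverse>" unfolding parcs image_arcs by auto
    have \<Sigma>: "pair_graph ?\<Sigma>"
    proof
      have sub: "parcs ?\<Sigma> \<subseteq> Y \<times> Y" using H.orbital_subset[OF D] parcs by auto
      then show "fst e \<in> pverts ?\<Sigma>" "snd e \<in> pverts ?\<Sigma>" if "e \<in> parcs ?\<Sigma>" for e
        using that by (auto simp: pverts)
      show "finite (pverts ?\<Sigma>)" "finite (parcs ?\<Sigma>)"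
        using finY sub by (auto simp: pverts intro: finite_subset)
      show "fst e \<noteq> snd e" if "e \<in> parcs ?\<Sigma>" for e
        using that \<open>D \<inter> Id = {}\<close> by (cases e) (auto simp: parcs)
      show "symmetric (with_proj ?\<Sigma>)" by (auto simp: symmetric_def parcs sym_def)
    qed
    have Aut: "subgroup H (perm_group (pverts ?\<Sigma>) (Aut ?\<Sigma>))"
      unfolding subgroup_of_Aut_iff
      using H.subgroup_Bij H.orbital_union_subset_Aut[OF D pverts parcs] by (simp add: pverts)
    obtain s where s: "s > 0"
      "\<And>B C x. (B, C) \<in> D \<Longrightarrow> x \<in> B \<Longrightarrow> card (C \<inter> \<Delta> `` {x}) = s"
      "\<And>x. x \<in> X \<Longrightarrow> card (\<Delta> `` {x}) = card (D `` {N_orbit x}) * s"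
      using orbital_fibres[OF \<Delta>(1) fin] unfolding D_def by metis
    obtain t where t: "t > 0"
      "\<And>B C x. (B, C) \<in> D\<inverse> \<Longrightarrow> x \<in> B \<Longrightarrow> card (C \<inter> \<Delta>\<inverse> `` {x}) = t"
      "\<And>x. x \<in> X \<Longrightarrow> card (\<Delta>\<inverse> `` {x}) = card (D\<inverse> `` {N_orbit x}) * t"
      using orbital_fibres[OF orbital_converse[OF \<Delta>(1)] fin] unfolding Dc by metis
    have in_D: "card (D\<inverse> `` {N_orbit x}) = card (D `` {N_orbit x})" if "x \<in> X" for x
      using H.orbital_out_eq_in[OF D finY] that by (simp add: Y_eq)
    have finI: "finite (\<Delta> `` {x})" "finite (\<Delta>\<inverse> `` {x})" for x
      using orbital_subset[OF \<Delta>(1)] fin by (auto intro: finite_subset)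
    have finD: "finite (D `` {B})" "finite (D\<inverse> `` {B})" for B
      using H.orbital_subset[OF D] finY by (auto intro: finite_subset)
    \<comment> \<open>Out-neighbours and in-neighbours are disjoint and equally many.\<close>
    have half: "m = 2 * card (\<Delta> `` {x})" if x: "x \<in> X" for x
    proof -
      have "m = card (\<Delta> `` {x} \<union> \<Delta>\<inverse> `` {x})"
        using \<Gamma>(4) x unfolding has_valency_def out_degree_with_proj \<Delta>(3) \<Gamma>(2) by (simp add: Un_Image)
      also have "\<dots> = card (\<Delta> `` {x}) + card (\<Delta>\<inverse> `` {x})"
        using \<Delta>(2) by (intro card_Un_disjoint finI) auto
      finally show ?thesis using orbital_out_eq_in[OF \<Delta>(1) fin x] by simp
    qed
    define k where "k = card (D `` {N_orbit x\<^sub>0})"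
    have m: "m = 2 * k * s" using half[OF x\<^sub>0] s(3)[OF x\<^sub>0] by (simp add: k_def)
    then have k: "k > 0" using \<Gamma>(5) by simp
    \<comment> \<open>Out-degree equals in-degree both for \<open>\<Delta>\<close> on the vertices
      and for \<open>D\<close> on the \<open>N\<close>-orbits, so the two fibre sizes agree after
      cancelling \<open>k\<close>.\<close>
    have "k * s = k * t"
      using orbital_out_eq_in[OF \<Delta>(1) fin x\<^sub>0] s(3)[OF x\<^sub>0] t(3)[OF x\<^sub>0] in_D[OF x\<^sub>0]
      unfolding k_def by metis
    then have st: "t = s" using k by simp
    \<comment> \<open>\<open>k\<close> was defined at \<open>x\<^sub>0\<close>; as \<open>m\<close>
      and \<open>s\<close> are constant, every vertex of the quotient yields the same value.\<close>
    have out_D: "card (D `` {B}) = k" "card (D\<inverse> `` {B}) = k" if B: "B \<in> Y" for B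
    proof -
      obtain x where x: "x \<in> X" "B = N_orbit x" using B by (auto simp: Y_eq)
      have "2 * (card (D `` {B}) * s) = 2 * k * s"
        unfolding x(2) using half[OF x(1)] s(3)[OF x(1)] m by metis
      then show "card (D `` {B}) = k" using s(1) by simp
      then show "card (D\<inverse> `` {B}) = k" using in_D[OF x(1)] x(2) by simp
    qed
    \<comment> \<open>Used contrapositively in the oriented case: if \<open>(B, C)\<close> is not in
      \<open>D\<close>, no pair of \<open>\<Delta>\<close> leads from \<open>B\<close> to
      \<open>C\<close>.\<close>
    have D_arc: "(B, C) \<in> D" if "(B, C) \<in> parcs ?\<Sigma>" "x \<in> B" "y \<in> C" "(x, y) \<in> \<Delta>" for B C x y
    proof -
      have "B \<in> Y" "C \<in> Y" using that(1) H.orbital_subset[OF D] parcs by auto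
      then have "B = N_orbit x" "C = N_orbit y" using that mem_Y by blast+
      then show ?thesis using that(4) by (force simp: D_def)
    qed
    have D_arc': "(B, C) \<in> D\<inverse>" if "(B, C) \<in> parcs ?\<Sigma>" "x \<in> B" "y \<in> C" "(x, y) \<in> \<Delta>\<inverse>" for B C x y
      using D_arc[of C B y x] that by (auto simp: parcs)
    have fibre: "{y \<in> C. (x, y) \<in> parcs \<Gamma>} = (C \<inter> \<Delta> `` {x}) \<union> (C \<inter> \<Delta>\<inverse> `` {x})" for x C
      using \<Delta>(3) by auto
    consider "D = D\<inverse>" | "D \<inter> D\<inverse> = {}"
      using H.orbitals_disjoint[OF D H.orbital_converse[OF D]] by blast
    then show ?thesis
    proof cases
      case 1
      then have parcs: "parcs ?\<Sigma> = D" using parcs by simp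
      have "has_valency ?\<Sigma> k"
        using out_D(1) by (simp add: has_valency_def out_degree_with_proj pverts parcs)
      moreover have "arc_transitive ?\<Sigma> H" by (rule H.arc_transitive_orbital[OF D pverts parcs])
      ultimately have "(?\<Sigma>, H) \<in> AG k" using k \<Sigma> conn Aut by (simp add: AG_def)
      moreover have "multicover (2 * s) \<Gamma> N"
        unfolding multicover_def
      proof clarify
        fix B C x assume BC: "(B, C) \<in> parcs ?\<Sigma>" "x \<in> B"
        \<comment> \<open>By symmetry of \<open>D\<close> the orbit \<open>C\<close> contains both
          out-neighbours and in-neighbours of \<open>x\<close>, with \<open>s\<close> of
          each.\<close>
        then have "(B, C) \<in> D" "(B, C) \<in> D\<inverse>" using parcs 1 by auto
        then have "card (C \<inter> \<Delta> `` {x}) = s" "card (C \<inter> \<Delta>\<inverse> `` {x}) = s"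
          using s(2) t(2) st BC(2) by blast+
        moreover have "(C \<inter> \<Delta> `` {x}) \<inter> (C \<inter> \<Delta>\<inverse> `` {x}) = {}" using \<Delta>(2) by auto
        ultimately show "card {y \<in> C. (x, y) \<in> parcs \<Gamma>} = 2 * s"
          unfolding fibre using finI by (subst card_Un_disjoint) auto
      qed
      moreover have "m div k = 2 * s" "k dvd m" "k \<le> m div 2" using k s(1) by (simp_all add: m)
      ultimately show ?thesis using k by (intro disjI2 exI[of _ k]) auto
    next
      case 2
      have "has_valency ?\<Sigma> (2 * k)"
        unfolding has_valency_def out_degree_with_proj pverts
      proof
        fix B assume "B \<in> Y"
        then show "card (parcs ?\<Sigma> `` {B}) = 2 * k"
          unfolding parcs Un_Image using 2 out_D finD by (subst card_Un_disjoint) auto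
      qed
      moreover have "vertex_transitive ?\<Sigma> H"
        unfolding vertex_transitive_def pverts by (rule H.transitive_action_id)
      moreover have "edge_transitive ?\<Sigma> H" by (rule H.edge_transitive_orbital[OF D pverts parcs])
      moreover have "oriented ?\<Sigma> H" unfolding oriented_def pverts using D 2 parcs by blast
      ultimately have "(?\<Sigma>, H) \<in> OG (2 * k)" using k \<Sigma> conn Aut by (simp add: OG_def)
      moreover have "multicover s \<Gamma> N"
        unfolding multicover_def
      proof clarify
        fix B C x assume BC: "(B, C) \<in> parcs ?\<Sigma>" "x \<in> B"
        \<comment> \<open>Each quotient arc has exactly one direction, so only one of the two kinds
          of neighbours of \<open>x\<close> meets \<open>C\<close>.\<close>
        then consider "(B, C) \<in> D" "(B, C) \<notin> D\<inverse>" | "(B, C) \<in> D\<inverse>" "(B, C) \<notin> D"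
          using parcs 2 by blast
        then show "card {y \<in> C. (x, y) \<in> parcs \<Gamma>} = s"
        proof cases
          case 1
          then have "C \<inter> \<Delta>\<inverse> `` {x} = {}" using D_arc'[OF BC] by blast
          then show ?thesis unfolding fibre using s(2)[OF 1(1) BC(2)] by simp
        next
          case 2
          then have "C \<inter> \<Delta> `` {x} = {}" using D_arc[OF BC] by blast
          then show ?thesis unfolding fibre using t(2)[OF 2(1) BC(2)] st by simp
        qed
      qed
      moreover have "m div (2 * k) = s" "2 * k dvd m" using k by (simp_all add: m)
      ultimately show ?thesis by (intro disjI2 disjI1 exI[of _ "2 * k"]) auto
    qed
  qed
qed

end

theorem proposition3p1:
  fixes \<Gamma> :: "'a pair_pre_digraph" and G N :: "('a \<Rightarrow> 'a) set" and X :: "'a set" and m :: nat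
  assumes "even m" and "m \<ge> 4"
    and "(\<Gamma>, G) \<in> OG m"
    and "X = pverts \<Gamma>"
    and "N \<lhd> perm_group X G"
  shows "connected (with_proj (normal_quotient \<Gamma> N)) \<and>
    group_action (perm_group X G) (orbits_on X N) (act_sets (orbits_on X N)) \<and>
    ((\<exists>B. normal_quotient \<Gamma> N = \<lparr>pverts = {B}, parcs = {}\<rparr>) \<and>
       induced_group X G N = {\<lambda>B \<in> orbits_on X N. B}
     \<or> (\<exists>k. even k \<and> k dvd m \<and>
          (normal_quotient \<Gamma> N, induced_group X G N) \<in> OG k \<and>
          multicover (m div k) \<Gamma> N)
     \<or> (\<exists>k. k dvd m \<and> even (m div k) \<and> 1 \<le> k \<and> k \<le> m div 2 \<and>
          (normal_quotient \<Gamma> N, induced_group X G N) \<in> AG k \<and>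
          multicover (m div k) \<Gamma> N))"
proof -
  have \<Gamma>: "pair_graph \<Gamma>" "connected (with_proj \<Gamma>)" "has_valency \<Gamma> m"
    "subgroup G (BijGroup X)" "vertex_transitive \<Gamma> G" "oriented \<Gamma> G"
    using assms(3,4) by (auto simp: OG_def subgroup_of_Aut_iff)
  \<comment> \<open>Vertex-transitivity in pointwise form, as the locale of transitive groups
    requires it.\<close>
  have "\<exists>g \<in> G. g x = y" if "x \<in> X" "y \<in> X" for x y
    using transitive_action.unique_orbit[of _ X] \<Gamma>(5) that assms(4)
    by (fastforce simp: vertex_transitive_def)
  then interpret normal_subgroup_orbits X G N
    by (intro normal_subgroup_orbits.intro transitive_permutation_group.intro
        permutation_group.intro transitive_permutation_group_axioms.intro
        normal_subgroup_orbits_axioms.intro \<Gamma>(4) assms(5))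
  obtain \<Delta> where \<Delta>: "\<Delta> \<in> orbitals" "\<Delta> \<inter> \<Delta>\<inverse> = {}" "parcs \<Gamma> = \<Delta> \<union> \<Delta>\<inverse>"
    using \<Gamma>(6) unfolding oriented_def assms(4)[symmetric] by blast
  have "parcs \<Gamma> \<subseteq> X \<times> X" using orbital_subset[OF \<Delta>(1)] \<Delta>(3) by auto
  moreover have "m > 0" using assms(2) by simp
  ultimately show ?thesis
    using connected_normal_quotient[OF assms(4)[symmetric] _ \<Gamma>(2)] group_action_Y
      normal_quotient_cases[OF \<Gamma>(1) assms(4)[symmetric] \<Gamma>(2,3) _ \<Delta>]
    by blast
qed

end
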